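(* Let $M$ be a paving matroid. Then $M$ is base-orderable if and only if $M$ has no minor isomorphic to $M(K_4)$.
   Context: All matroids are finite. A matroid $M$ is paving if it contains no circuit of size less than its rank $r(M)$. A matroid $M$ is base-orderable if, given any two bases $B_1$ and $B_2$, there is a bijection $\sigma : B_1 \to B_2$ such that for every $x \in B_1$, both $(B_1 - \{x\}) \cup \{\sigma(x)\}$ and $(B_2 - \{\sigma(x)\}) \cup \{x\}$ are bases of $M$. $M(K_4)$ is the cycle matroid of the complete graph $K_4$. *)

theory Defs
  imports "HOL-Library.Ramsey"
begin

record 'a matroid_data =
  ground :: "'a set"
  indeps :: "'a set set"

locale matroid =
  fixes M :: "'a matroid_data"
  assumes finite_ground: "finite (ground M)"
    and indep_subset_ground: "I \<in> indeps M \<Longrightarrow> I \<subseteq> ground M"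
    and indep_empty: "{} \<in> indeps M"
    and indep_hereditary: "\<lbrakk>I \<in> indeps M; J \<subseteq> I\<rbrakk> \<Longrightarrow> J \<in> indeps M"
    and indep_augment:
      "\<lbrakk>I \<in> indeps M; J \<in> indeps M; card I < card J\<rbrakk> \<Longrightarrow> \<exists>x\<in>J - I. insert x I \<in> indeps M"

definition basis_of :: "'a matroid_data \<Rightarrow> 'a set \<Rightarrow> 'a set \<Rightarrow> bool" where
  "basis_of M X B \<longleftrightarrow>
     B \<in> indeps M \<and> B \<subseteq> X \<and> (\<forall>J\<in>indeps M. B \<subseteq> J \<and> J \<subseteq> X \<longrightarrow> J = B)"

definition base :: "'a matroid_data \<Rightarrow> 'a set \<Rightarrow> bool" where
  "base M B \<longleftrightarrow> basis_of M (ground M) B"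

definition rank :: "'a matroid_data \<Rightarrow> nat" where
  "rank M = Max (card ` indeps M)"

definition circuit :: "'a matroid_data \<Rightarrow> 'a set \<Rightarrow> bool" where
  "circuit M C \<longleftrightarrow> C \<subseteq> ground M \<and> C \<notin> indeps M \<and> (\<forall>D. D \<subset> C \<longrightarrow> D \<in> indeps M)"

definition paving :: "'a matroid_data \<Rightarrow> bool" where
  "paving M \<longleftrightarrow> \<not> (\<exists>C. circuit M C \<and> card C < rank M)"

definition base_orderable :: "'a matroid_data \<Rightarrow> bool" where
  "base_orderable M \<longleftrightarrow>
     (\<forall>B1 B2. base M B1 \<and> base M B2 \<longrightarrow>
        (\<exists>\<sigma>. bij_betw \<sigma> B1 B2 \<and>
           (\<forall>x\<in>B1. base M ((B1 - {x}) \<union> {\<sigma> x}) \<and> base M ((B2 - {\<sigma> x}) \<union> {x}))))"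

definition delete :: "'a matroid_data \<Rightarrow> 'a set \<Rightarrow> 'a matroid_data" where
  "delete M X = \<lparr>ground = ground M - X, indeps = {I \<in> indeps M. I \<subseteq> ground M - X}\<rparr>"

text \<open>In a matroid, whether \<open>I \<union> B\<close> is independent does not depend on the basis \<open>B\<close> of \<open>X\<close>.\<close>

definition contract :: "'a matroid_data \<Rightarrow> 'a set \<Rightarrow> 'a matroid_data" where
  "contract M X =
     \<lparr>ground = ground M - X,
      indeps = {I. I \<subseteq> ground M - X \<and> (\<exists>B. basis_of M X B \<and> I \<union> B \<in> indeps M)}\<rparr>"

definition minor :: "'a matroid_data \<Rightarrow> 'a matroid_data \<Rightarrow> bool" where
  "minor N M \<longleftrightarrow>
     (\<exists>C D. C \<subseteq> ground M \<and> D \<subseteq> ground M \<and> C \<inter> D = {} \<and> N = delete (contract M C) D)"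

definition matroid_isomorphic :: "'a matroid_data \<Rightarrow> 'b matroid_data \<Rightarrow> bool" where
  "matroid_isomorphic M N \<longleftrightarrow>
     (\<exists>f. bij_betw f (ground M) (ground N) \<and>
        (\<forall>I. I \<subseteq> ground M \<longrightarrow> (I \<in> indeps M \<longleftrightarrow> f ` I \<in> indeps N)))"

text \<open>
  A simple graph is given by its set of edges, each a two-element set of vertices.
  Isolated vertices play no role in the cycle matroid.
\<close>

definition cycle_edges :: "'v list \<Rightarrow> 'v set set" where
  "cycle_edges vs = {{vs ! i, vs ! (Suc i mod length vs)} | i. i < length vs}"

definition graph_cycle :: "'v set set \<Rightarrow> 'v set set \<Rightarrow> bool" where
  "graph_cycle E C \<longleftrightarrow>
     (\<exists>vs. length vs \<ge> 3 \<and> distinct vs \<and> C = cycle_edges vs \<and> C \<subseteq> E)"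

definition cycle_matroid :: "'v set set \<Rightarrow> 'v set matroid_data" where
  "cycle_matroid E =
     \<lparr>ground = E, indeps = {F. F \<subseteq> E \<and> \<not> (\<exists>C. graph_cycle E C \<and> C \<subseteq> F)}\<rparr>"

definition complete_graph :: "nat \<Rightarrow> nat set set" where
  "complete_graph n = nsets {..<n} 2"

end

theory Submission
  imports Defs
begin

text \<open>
  Write a candidate exchange of \<open>x \<in> B1\<close> with \<open>y \<in> B2\<close> as an edge of a bipartite graph. A bijection
  as in base-orderability has to fix \<open>B1 \<inter> B2\<close>, so it is the same thing as a perfect matching between
  \<open>B1 - B2\<close> and \<open>B2 - B1\<close>, and Hall's theorem says when there is none: some \<open>X \<subseteq> B1 - B2\<close> and
  \<open>Y \<subseteq> B2 - B1\<close> with \<open>|X| + |Y| > |B1 - B2|\<close> have no edge between them.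

  In a paving matroid every set with fewer elements than the rank is independent. An outside element
  \<open>y\<close> therefore has a fundamental circuit with respect to \<open>B1\<close> that misses at most one element of \<open>B1\<close>:
  there is at most one \<open>x\<close> for which \<open>B1 - x + y\<close> is dependent
  (\<open>paving_blocked_unique\<close>), and the same holds with the bases interchanged. So the \<open>|X| |Y|\<close> missing
  edges number at most \<open>|X| + |Y|\<close>. Symmetric exchange (\<open>paving_symmetric_exchange\<close>) excludes
  \<open>|X| = 1\<close> and \<open>|Y| = 1\<close>, so both have exactly two elements and \<open>|B1 - B2| \<le> 3\<close>
  (\<open>paving_blocked_rectangle\<close>). Each of the four missing edges has exactly one cause, and chasing the
  causes around the square excludes \<open>|B1 - B2| = 2\<close>. If \<open>|B1 - B2| = 3\<close>, it produces, after
  contraction of \<open>B1 \<inter> B2\<close>, six points carrying four three-point lines, any two of which share one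
  point. This is the complete quadrilateral, that is, \<open>M(K\<^sub>4)\<close>
  (\<open>K4_minor_if_blocked_square\<close>, \<open>K4_minor_if_quadrilateral\<close>).

  Conversely, take in \<open>M(K\<^sub>4)\<close> the two bases \<open>{x1, x2, x3}\<close> and \<open>{y1, y2, y3}\<close> of this very
  picture. Neither \<open>x1\<close> nor \<open>x2\<close> can be exchanged with \<open>y1\<close> or \<open>y2\<close>, so both would have to be matched
  with \<open>y3\<close>. If \<open>M(K\<^sub>4)\<close> is a minor, the two bases can be extended to bases of \<open>M\<close> by one and the
  same set of elements, and the obstruction persists (\<open>not_base_orderable_if_K4_minor\<close>).
\<close>

section \<open>Hall's marriage theorem\<close>

text \<open>
  The argument of Halmos and Vaughan, by induction on the number of indices. If a nonempty proper
  subfamily \<open>J\<close> is tight, match it inside its own neighbourhood \<open>N\<close>; after deletion of \<open>N\<close> the remaining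
  sets still satisfy Hall's condition, because a violation would, together with \<open>J\<close>, violate the original
  one. If there is no tight subfamily, any single choice costs the others at most one neighbour,
  which they can afford.
\<close>

theorem hall_marriage:
  assumes "finite I" and "\<And>i. i \<in> I \<Longrightarrow> finite (A i)"
    and "\<And>J. J \<subseteq> I \<Longrightarrow> card J \<le> card (\<Union>(A ` J))"
  shows "\<exists>f. inj_on f I \<and> (\<forall>i\<in>I. f i \<in> A i)"
  using assms
proof (induction "card I" arbitrary: I A rule: less_induct)
  case less
  note finI = less.prems(1) and finA = less.prems(2) and hall = less.prems(3)
  have finN: "finite (\<Union>(A ` J))" if "J \<subseteq> I" for J
    using that finA finite_subset[OF that finI] by blast
  show ?case
  proof (cases "\<exists>J. J \<subset> I \<and> J \<noteq> {} \<and> card (\<Union>(A ` J)) = card J")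
    case True
    then obtain J where J: "J \<subset> I" "J \<noteq> {}" and tight: "card (\<Union>(A ` J)) = card J"
      by blast
    let ?N = "\<Union>(A ` J)"
    have finJ: "finite J" using J finI by (meson finite_subset psubset_imp_subset)
    have "\<exists>f. inj_on f J \<and> (\<forall>i\<in>J. f i \<in> A i)"
    proof (rule less.hyps)
      show "card J < card I" using J finI by (simp add: psubset_card_mono)
      show "finite (A i)" if "i \<in> J" for i using that J finA by blast
      show "card K \<le> card (\<Union>(A ` K))" if "K \<subseteq> J" for K using that J by (intro hall) blast
    qed (rule finJ)
    then obtain f where f: "inj_on f J" "\<And>i. i \<in> J \<Longrightarrow> f i \<in> A i" by blast
    have "\<exists>g. inj_on g (I - J) \<and> (\<forall>i\<in>I - J. g i \<in> A i - ?N)"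
    proof (rule less.hyps)
      show "card (I - J) < card I"
        using J finI by (intro psubset_card_mono) auto
      show "card K \<le> card (\<Union>i\<in>K. A i - ?N)" if K: "K \<subseteq> I - J" for K
      proof -
        have finK: "finite K" using K finI finite_subset by blast
        have "card K + card J = card (K \<union> J)"
          using K finK finJ by (intro card_Un_disjoint[symmetric]) auto
        also have "\<dots> \<le> card (\<Union>(A ` (K \<union> J)))"
          using K J by (intro hall) auto
        also have "\<Union>(A ` (K \<union> J)) = (\<Union>i\<in>K. A i - ?N) \<union> ?N" by auto
        also have "card \<dots> \<le> card (\<Union>i\<in>K. A i - ?N) + card ?N"
          by (rule card_Un_le)
        finally show ?thesis using tight by simp
      qed
    qed (simp_all add: finI finA)
    then obtain g where g: "inj_on g (I - J)" "\<And>i. i \<in> I - J \<Longrightarrow> g i \<in> A i - ?N" by blast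
    let ?h = "\<lambda>i. if i \<in> J then f i else g i"
    have apart: "f i \<noteq> g j" if "i \<in> J" "j \<in> I - J" for i j
      using f(2)[OF that(1)] g(2)[OF that(2)] that(1) by (metis DiffD2 UN_I)
    have "inj_on ?h I"
    proof (rule inj_onI)
      fix i j assume ij: "i \<in> I" "j \<in> I" "?h i = ?h j"
      then show "i = j"
        using inj_onD[OF f(1), of i j] inj_onD[OF g(1), of i j] apart[of i j] apart[of j i]
        by (cases "i \<in> J"; cases "j \<in> J") simp_all
    qed
    moreover have "\<forall>i\<in>I. ?h i \<in> A i" using f(2) g(2) by simp
    ultimately show ?thesis by blast
  next
    case loose: False
    show ?thesis
    proof (cases "I = {}")
      case True
      then show ?thesis by simp
    next
      case ne: False
      then obtain i where i: "i \<in> I" by blast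
      have "card {i} \<le> card (A i)" using hall[of "{i}"] i by simp
      then have "A i \<noteq> {}" by auto
      then obtain a where a: "a \<in> A i" by blast
      have "\<exists>g. inj_on g (I - {i}) \<and> (\<forall>j\<in>I - {i}. g j \<in> A j - {a})"
      proof (rule less.hyps)
        show "card (I - {i}) < card I" using i finI by (meson card_Diff1_less)
        show "card J \<le> card (\<Union>j\<in>J. A j - {a})" if J: "J \<subseteq> I - {i}" for J
        proof (cases "J = {}")
          case False
          have "J \<subset> I" using J i by blast
          then have "card (\<Union>(A ` J)) \<noteq> card J" using loose False by blast
          moreover have "card J \<le> card (\<Union>(A ` J))" using \<open>J \<subset> I\<close> by (intro hall) blast
          ultimately have "card J \<le> card (\<Union>(A ` J)) - 1" by simp
          also have "\<dots> \<le> card (\<Union>(A ` J) - {a})" by (simp add: card_Diff_singleton_if)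
          also have "\<Union>(A ` J) - {a} = (\<Union>j\<in>J. A j - {a})" by auto
          finally show ?thesis .
        qed simp
      qed (simp_all add: finI finA)
      then obtain g where g: "inj_on g (I - {i})" "\<And>j. j \<in> I - {i} \<Longrightarrow> g j \<in> A j - {a}"
        by blast
      have "a \<notin> g ` (I - {i})" using g(2) by blast
      then have "inj_on (g(i := a)) (insert i (I - {i}))"
        using g(1) unfolding inj_on_insert by (simp add: inj_on_fun_updI fun_upd_image)
      then have "inj_on (g(i := a)) I" using i by (simp add: insert_absorb)
      moreover have "\<forall>j\<in>I. (g(i := a)) j \<in> A j" using g(2) a by simp
      ultimately show ?thesis by blast
    qed
  qed
qed

section \<open>The cycle matroid of the complete graph on four vertices\<close>

text \<open>
  The four triangles and the three 4-cycles of \<open>K\<^sub>4\<close>, written in terms of its six edges. The pairs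
  \<open>(x1, x2)\<close>, \<open>(x3, y3)\<close> and \<open>(y1, y2)\<close> are the opposite edges; \<open>{x1, x2, x3}\<close> and \<open>{y1, y2, y3}\<close> are
  paths. The names are those that the six points receive in the complete quadrilateral spanned by two
  bases \<open>{x1, x2, x3}\<close> and \<open>{y1, y2, y3}\<close>.
\<close>

definition K4_circuits :: "'a \<Rightarrow> 'a \<Rightarrow> 'a \<Rightarrow> 'a \<Rightarrow> 'a \<Rightarrow> 'a \<Rightarrow> 'a set set" where
  "K4_circuits x1 x2 x3 y1 y2 y3 =
     {{x2, x3, y1}, {x1, x3, y2}, {x2, y2, y3}, {x1, y1, y3},
      {x3, y3, y1, y2}, {x1, x2, y1, y2}, {x1, x2, x3, y3}}"

abbreviation K4_cycles :: "nat set set set" where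
  "K4_cycles \<equiv> K4_circuits {0, 2} {1, 3} {2, 3} {1, 2} {0, 3} {0, 1}"

lemma complete_graph_4: "complete_graph 4 = {{0, 2}, {1, 3}, {2, 3}, {1, 2}, {0, 3}, {0, 1}}"
proof -
  have "{..<4::nat} = {0, 1, 2, 3}" by auto
  then show ?thesis
    unfolding complete_graph_def by (simp add: nsets_2_eq insert_Diff_if insert_commute)
qed

lemma cycle_edges_eq_image:
  "cycle_edges vs = (\<lambda>i. {vs ! i, vs ! (Suc i mod length vs)}) ` {..<length vs}"
  by (auto simp: cycle_edges_def)

lemma cycle_edges_3: "cycle_edges [a, b, c] = {{a, b}, {b, c}, {c, a}}"
  by (simp add: cycle_edges_eq_image lessThan_Suc insert_commute)

lemma cycle_edges_4: "cycle_edges [a, b, c, d] = {{a, b}, {b, c}, {c, d}, {d, a}}"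
  by (simp add: cycle_edges_eq_image lessThan_Suc insert_commute)

text \<open>
  The vertices of a cycle in \<open>K\<^sub>4\<close> are distinct and less than 4, so a cycle is given by one of finitely
  many vertex lists of length 3 or 4, which can be run through.
\<close>

lemma graph_cycle_K4_iff: "graph_cycle (complete_graph 4) C \<longleftrightarrow> C \<in> K4_cycles"
proof
  assume "graph_cycle (complete_graph 4) C"
  then obtain vs where vs: "length vs \<ge> 3" "distinct vs" "C = cycle_edges vs"
    and sub: "C \<subseteq> complete_graph 4"
    unfolding graph_cycle_def by (elim exE conjE)
  have "vs ! i < 4" if "i < length vs" for i
  proof -
    have "{vs ! i, vs ! (Suc i mod length vs)} \<in> complete_graph 4"
      using sub vs(3) that by (auto simp: cycle_edges_def)
    then show ?thesis by (auto simp: complete_graph_def nsets_def)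
  qed
  then have V: "set vs \<subseteq> {..<4}" by (auto simp: in_set_conv_nth)
  have four: "{..<4::nat} = {0, 1, 2, 3}" by auto
  have "length vs \<le> 4"
    using card_mono[OF finite_lessThan V] distinct_card[OF vs(2)] by simp
  then consider "length vs = 3" | "length vs = 4" using vs(1) by linarith
  then show "C \<in> K4_cycles"
  proof cases
    case 1
    then obtain a b c where abc: "vs = [a, b, c]"
      by (auto simp: length_Suc_conv numeral_3_eq_3)
    moreover have "\<forall>a\<in>{0, 1, 2, 3}. \<forall>b\<in>{0, 1, 2, 3}. \<forall>c\<in>{0, 1, 2, 3}.
        distinct [a, b, c] \<longrightarrow> cycle_edges [a, b, c] \<in> K4_cycles"
      by (simp add: cycle_edges_3 K4_circuits_def insert_commute)
    ultimately show ?thesis using V vs(2) unfolding vs(3) abc four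
      by (simp only: list.set insert_subset)
  next
    case 2
    then obtain a b c d where abcd: "vs = [a, b, c, d]"
      by (auto simp: length_Suc_conv eval_nat_numeral)
    moreover have "\<forall>a\<in>{0, 1, 2, 3}. \<forall>b\<in>{0, 1, 2, 3}. \<forall>c\<in>{0, 1, 2, 3}. \<forall>d\<in>{0, 1, 2, 3}.
        distinct [a, b, c, d] \<longrightarrow> cycle_edges [a, b, c, d] \<in> K4_cycles"
      by (simp add: cycle_edges_4 K4_circuits_def insert_commute)
    ultimately show ?thesis using V vs(2) unfolding vs(3) abcd four
      by (simp only: list.set insert_subset)
  qed
next
  have cyc: "graph_cycle (complete_graph 4) (cycle_edges vs)"
    if "length vs \<ge> 3 \<and> distinct vs \<and> cycle_edges vs \<subseteq> complete_graph 4" for vs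
    using that unfolding graph_cycle_def by (intro exI conjI) simp_all
  assume "C \<in> K4_cycles"
  moreover have "\<forall>vs \<in> {[1, 2, 3], [0, 2, 3], [0, 1, 3], [0, 1, 2],
      [0, 1, 2, 3], [0, 2, 1, 3], [0, 1, 3, 2]}. graph_cycle (complete_graph 4) (cycle_edges vs)"
    by (intro ballI cyc, elim insertE emptyE)
      (simp_all add: complete_graph_4 cycle_edges_3 cycle_edges_4 insert_commute)
  ultimately show "graph_cycle (complete_graph 4) C"
    unfolding K4_circuits_def
    by (elim insertE emptyE) (simp_all add: cycle_edges_3 cycle_edges_4 insert_commute)
qed

lemma image_K4_circuits:
  "(`) f ` K4_circuits x1 x2 x3 y1 y2 y3 = K4_circuits (f x1) (f x2) (f x3) (f y1) (f y2) (f y3)"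
  by (simp add: K4_circuits_def)

lemma inj_on_image_subset_iff:
  assumes "inj_on f A" and "B \<subseteq> A" and "C \<subseteq> A"
  shows "f ` B \<subseteq> f ` C \<longleftrightarrow> B \<subseteq> C"
  using inj_on_image_mem_iff[OF assms(1) _ assms(3)] assms(2)
  unfolding image_subset_iff by blast

text \<open>
  This trades graphs and isomorphisms for a labelling of the ground set by six names, in which both
  directions of the theorem can argue.
\<close>

lemma isomorphic_M_K4_iff:
  "matroid_isomorphic N (cycle_matroid (complete_graph 4)) \<longleftrightarrow>
    (\<exists>x1 x2 x3 y1 y2 y3. distinct [x1, x2, x3, y1, y2, y3] \<and>
       ground N = {x1, x2, x3, y1, y2, y3} \<and>
       (\<forall>I \<subseteq> ground N. I \<in> indeps N \<longleftrightarrow> (\<forall>C \<in> K4_circuits x1 x2 x3 y1 y2 y3. \<not> C \<subseteq> I)))"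
  (is "_ \<longleftrightarrow> ?R")
proof -
  let ?E = "complete_graph 4"
  have indep: "F \<in> indeps (cycle_matroid ?E) \<longleftrightarrow> (\<forall>C \<in> K4_cycles. \<not> C \<subseteq> F)" if "F \<subseteq> ?E" for F
    using that by (auto simp: cycle_matroid_def graph_cycle_K4_iff)
  have ground: "ground (cycle_matroid ?E) = ?E" by (simp add: cycle_matroid_def)
  show ?thesis
  proof
    assume "matroid_isomorphic N (cycle_matroid ?E)"
    then obtain f where f: "bij_betw f (ground N) ?E"
      and fI: "\<And>I. I \<subseteq> ground N \<Longrightarrow> I \<in> indeps N \<longleftrightarrow> f ` I \<in> indeps (cycle_matroid ?E)"
      unfolding matroid_isomorphic_def ground by blast
    define g where "g = inv_into (ground N) f"
    have g: "bij_betw g ?E (ground N)" unfolding g_def by (rule bij_betw_inv_into[OF f])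
    have fg: "f (g e) = e" if "e \<in> ?E" for e
      unfolding g_def using bij_betw_inv_into_right[OF f that] .
    have K: "K4_circuits (g {0, 2}) (g {1, 3}) (g {2, 3}) (g {1, 2}) (g {0, 3}) (g {0, 1}) =
        (`) g ` K4_cycles" by (simp add: image_K4_circuits)
    have "(\<forall>C \<in> K4_cycles. \<not> C \<subseteq> f ` I) \<longleftrightarrow> (\<forall>C \<in> (`) g ` K4_cycles. \<not> C \<subseteq> I)"
      if I: "I \<subseteq> ground N" for I
    proof -
      have "C \<subseteq> f ` I \<longleftrightarrow> g ` C \<subseteq> I" if "C \<in> K4_cycles" for C
      proof -
        have C: "C \<subseteq> ?E"
          using that unfolding complete_graph_4 K4_circuits_def by (elim insertE emptyE) simp_all
        have "(\<lambda>e. f (g e)) ` C = (\<lambda>e. e) ` C"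
          using C fg by (intro image_cong) blast+
        then have "C \<subseteq> f ` I \<longleftrightarrow> f ` g ` C \<subseteq> f ` I" by (simp add: image_image)
        moreover have "g ` C \<subseteq> ground N"
          using image_mono[OF C, of g] bij_betw_imp_surj_on[OF g] by simp
        ultimately show ?thesis
          using inj_on_image_subset_iff[OF bij_betw_imp_inj_on[OF f] _ I] by simp
      qed
      then show ?thesis by simp
    qed
    moreover have "f ` I \<subseteq> ?E" if "I \<subseteq> ground N" for I
      using image_mono[OF that, of f] bij_betw_imp_surj_on[OF f] by simp
    ultimately have circuits: "\<forall>I \<subseteq> ground N. I \<in> indeps N \<longleftrightarrow> (\<forall>C \<in> (`) g ` K4_cycles. \<not> C \<subseteq> I)"
      using fI indep by simp
    have "distinct (map g [{0, 2}, {1, 3}, {2, 3}, {1, 2}, {0, 3}, {0, 1}])"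
      using bij_betw_imp_inj_on[OF g] unfolding distinct_map complete_graph_4
      by (simp add: doubleton_eq_iff del: inj_on_insert)
    then have distinct: "distinct [g {0, 2}, g {1, 3}, g {2, 3}, g {1, 2}, g {0, 3}, g {0, 1}]"
      by (simp only: list.map)
    have "ground N = {g {0, 2}, g {1, 3}, g {2, 3}, g {1, 2}, g {0, 3}, g {0, 1}}"
      using bij_betw_imp_surj_on[OF g] unfolding complete_graph_4 by simp
    with distinct circuits[folded K] show ?R
      by - (rule exI[of _ "g {0, 2}"], rule exI[of _ "g {1, 3}"], rule exI[of _ "g {2, 3}"],
          rule exI[of _ "g {1, 2}"], rule exI[of _ "g {0, 3}"], rule exI[of _ "g {0, 1}"],
          intro conjI)
  next
    assume ?R
    then obtain x1 x2 x3 y1 y2 y3 where d: "distinct [x1, x2, x3, y1, y2, y3]"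
      and gr: "ground N = {x1, x2, x3, y1, y2, y3}"
      and circuits: "\<forall>I \<subseteq> ground N.
        I \<in> indeps N \<longleftrightarrow> (\<forall>C \<in> K4_circuits x1 x2 x3 y1 y2 y3. \<not> C \<subseteq> I)" by (elim exE conjE)
    define f :: "'a \<Rightarrow> nat set" where
      "f = (\<lambda>_. {})(x1 := {0, 2}, x2 := {1, 3}, x3 := {2, 3}, y1 := {1, 2}, y2 := {0, 3}, y3 := {0, 1})"
    have f: "f x1 = {0, 2}" "f x2 = {1, 3}" "f x3 = {2, 3}" "f y1 = {1, 2}" "f y2 = {0, 3}" "f y3 = {0, 1}"
      using d by (auto simp: f_def)
    have inj: "inj_on f (ground N)"
      unfolding gr inj_on_def by (simp add: f doubleton_eq_iff)
    have img: "f ` ground N = ?E"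
      unfolding gr complete_graph_4 by (simp add: f)
    have K: "K4_cycles = (`) f ` K4_circuits x1 x2 x3 y1 y2 y3"
      by (simp add: image_K4_circuits f)
    have "J \<in> indeps N \<longleftrightarrow> f ` J \<in> indeps (cycle_matroid ?E)" if J: "J \<subseteq> ground N" for J
    proof -
      have "f ` C \<subseteq> f ` J \<longleftrightarrow> C \<subseteq> J" if C: "C \<in> K4_circuits x1 x2 x3 y1 y2 y3" for C
      proof (rule inj_on_image_subset_iff[OF inj _ J])
        show "C \<subseteq> ground N"
          using C unfolding gr K4_circuits_def by (elim insertE emptyE) simp_all
      qed
      moreover have "f ` J \<subseteq> ?E" using image_mono[OF J, of f] img by simp
      ultimately show ?thesis using circuits[rule_format, OF J] indep[of "f ` J"] unfolding K by simp
    qed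
    then show "matroid_isomorphic N (cycle_matroid ?E)"
      unfolding matroid_isomorphic_def ground bij_betw_def using inj img by blast
  qed
qed

text \<open>
  The sixteen spanning trees of \<open>K\<^sub>4\<close>. Independence is inherited by subsets, so to recognise
  \<open>M(K\<^sub>4)\<close> it is enough to check these sets instead of all sets without a circuit.
\<close>

definition K4_bases :: "'a \<Rightarrow> 'a \<Rightarrow> 'a \<Rightarrow> 'a \<Rightarrow> 'a \<Rightarrow> 'a \<Rightarrow> 'a set set" where
  "K4_bases x1 x2 x3 y1 y2 y3 =
     {{x1, x2, x3}, {y1, y2, y3},
      {x1, x2, y1}, {x1, x2, y2}, {x1, x2, y3}, {x1, x3, y1}, {x1, x3, y3}, {x2, x3, y2}, {x2, x3, y3},
      {x1, y1, y2}, {x1, y2, y3}, {x2, y1, y2}, {x2, y1, y3}, {x3, y1, y2}, {x3, y1, y3}, {x3, y2, y3}}"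

lemma K4_indep_subset_base:
  assumes J: "J \<subseteq> {x1, x2, x3, y1, y2, y3}" and "\<forall>C \<in> K4_circuits x1 x2 x3 y1 y2 y3. \<not> C \<subseteq> J"
  shows "\<exists>B \<in> K4_bases x1 x2 x3 y1 y2 y3. J \<subseteq> B"
proof -
  have "x1 \<notin> J \<and> x2 \<notin> J \<and> x3 \<notin> J \<Longrightarrow> J \<subseteq> {y1, y2, y3}"
    "y1 \<notin> J \<and> y2 \<notin> J \<and> y3 \<notin> J \<Longrightarrow> J \<subseteq> {x1, x2, x3}"
    "x3 \<notin> J \<and> y2 \<notin> J \<and> y3 \<notin> J \<Longrightarrow> J \<subseteq> {x1, x2, y1}"
    "x3 \<notin> J \<and> y1 \<notin> J \<and> y3 \<notin> J \<Longrightarrow> J \<subseteq> {x1, x2, y2}"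
    "x3 \<notin> J \<and> y1 \<notin> J \<and> y2 \<notin> J \<Longrightarrow> J \<subseteq> {x1, x2, y3}"
    "x2 \<notin> J \<and> y2 \<notin> J \<and> y3 \<notin> J \<Longrightarrow> J \<subseteq> {x1, x3, y1}"
    "x2 \<notin> J \<and> y1 \<notin> J \<and> y2 \<notin> J \<Longrightarrow> J \<subseteq> {x1, x3, y3}"
    "x1 \<notin> J \<and> y1 \<notin> J \<and> y3 \<notin> J \<Longrightarrow> J \<subseteq> {x2, x3, y2}"
    "x1 \<notin> J \<and> y1 \<notin> J \<and> y2 \<notin> J \<Longrightarrow> J \<subseteq> {x2, x3, y3}"
    "x2 \<notin> J \<and> x3 \<notin> J \<and> y3 \<notin> J \<Longrightarrow> J \<subseteq> {x1, y1, y2}"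
    "x2 \<notin> J \<and> x3 \<notin> J \<and> y1 \<notin> J \<Longrightarrow> J \<subseteq> {x1, y2, y3}"
    "x1 \<notin> J \<and> x3 \<notin> J \<and> y3 \<notin> J \<Longrightarrow> J \<subseteq> {x2, y1, y2}"
    "x1 \<notin> J \<and> x3 \<notin> J \<and> y2 \<notin> J \<Longrightarrow> J \<subseteq> {x2, y1, y3}"
    "x1 \<notin> J \<and> x2 \<notin> J \<and> y3 \<notin> J \<Longrightarrow> J \<subseteq> {x3, y1, y2}"
    "x1 \<notin> J \<and> x2 \<notin> J \<and> y2 \<notin> J \<Longrightarrow> J \<subseteq> {x3, y1, y3}"
    "x1 \<notin> J \<and> x2 \<notin> J \<and> y1 \<notin> J \<Longrightarrow> J \<subseteq> {x3, y2, y3}"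
    using J by blast+
  \<comment> \<open>What remains is propositional in the six statements \<open>x1 \<in> J\<close>, ..., \<open>y3 \<in> J\<close>.\<close>
  then show ?thesis
    using assms(2) unfolding K4_circuits_def K4_bases_def ball_simps bex_simps insert_subset
    by (cases "x1 \<in> J"; cases "x2 \<in> J"; cases "x3 \<in> J"; cases "y1 \<in> J"; cases "y2 \<in> J"; cases "y3 \<in> J";
        simp only: empty_subsetI simp_thms)
qed


section \<open>Bases, independence and contraction\<close>

context matroid
begin

lemma indep_finite: "I \<in> indeps M \<Longrightarrow> finite I"
  using finite_subset[OF indep_subset_ground finite_ground] .

lemma finite_indeps: "finite (indeps M)"
proof (rule finite_subset)
  show "indeps M \<subseteq> Pow (ground M)" using indep_subset_ground by blast
  show "finite (Pow (ground M))" using finite_ground by simp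
qed

lemma card_indep_le_rank: "I \<in> indeps M \<Longrightarrow> card I \<le> rank M"
  unfolding rank_def using finite_indeps by (intro Max_ge) simp_all

lemma indep_of_full_rank: "\<exists>B \<in> indeps M. card B = rank M"
proof -
  have "rank M \<in> card ` indeps M"
    unfolding rank_def using finite_indeps indep_empty by (intro Max_in) auto
  then show ?thesis by auto
qed

text \<open>
  The augmentation axiom in the form of a rank bound: the hypothesis says that \<open>T\<close> lies in the closure of
  the independent set \<open>S\<close>. All closure and hyperplane arguments below are instances of this, with \<open>T\<close>
  chosen too large.
\<close>

lemma card_indep_le_card_spanning:
  assumes "S \<in> indeps M" and "T \<in> indeps M"
    and "\<And>x. x \<in> T - S \<Longrightarrow> insert x S \<notin> indeps M"
  shows "card T \<le> card S"
proof (rule ccontr)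
  assume "\<not> card T \<le> card S"
  then have "\<exists>x\<in>T - S. insert x S \<in> indeps M" using indep_augment[OF assms(1,2)] by simp
  then show False using assms(3) by blast
qed

lemma indep_extend:
  assumes "I \<in> indeps M" and J: "J \<in> indeps M" and "card I \<le> card J"
  shows "\<exists>K \<in> indeps M. I \<subseteq> K \<and> K \<subseteq> I \<union> J \<and> card K = card J"
  using assms(1,3)
proof (induction "card J - card I" arbitrary: I)
  case 0
  then have "card I = card J" by simp
  then show ?case using 0 by (intro bexI[of _ I]) simp_all
next
  case (Suc n)
  then have "card I < card J" by simp
  then obtain x where x: "x \<in> J - I" "insert x I \<in> indeps M"
    using indep_augment[OF Suc.prems(1) J] by blast
  have c: "card (insert x I) = Suc (card I)" using x indep_finite[OF Suc.prems(1)] by simp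
  have "\<exists>K \<in> indeps M. insert x I \<subseteq> K \<and> K \<subseteq> insert x I \<union> J \<and> card K = card J"
    using Suc.hyps(1)[OF _ x(2)] Suc.hyps(2) c \<open>card I < card J\<close> by simp
  then obtain K where "K \<in> indeps M" "insert x I \<subseteq> K" "K \<subseteq> insert x I \<union> J" "card K = card J"
    by blast
  then show ?case using x(1) by (intro bexI[of _ K]) auto
qed

lemma base_iff_card: "base M B \<longleftrightarrow> B \<in> indeps M \<and> card B = rank M"
proof
  assume B: "base M B"
  then have ind: "B \<in> indeps M"
    and max: "\<And>J. J \<in> indeps M \<Longrightarrow> B \<subseteq> J \<Longrightarrow> J \<subseteq> ground M \<Longrightarrow> J = B"
    unfolding base_def basis_of_def by simp_all
  have "insert x B \<notin> indeps M" if "x \<notin> B" for x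
    using max[of "insert x B"] indep_subset_ground that by (metis insertI1 subset_insertI)
  then have "rank M \<le> card B"
    using indep_of_full_rank card_indep_le_card_spanning[OF ind] by (metis DiffD2)
  then show "B \<in> indeps M \<and> card B = rank M" using ind card_indep_le_rank[OF ind] by simp
next
  assume B: "B \<in> indeps M \<and> card B = rank M"
  have "J = B" if "J \<in> indeps M" "B \<subseteq> J" for J
    using card_seteq[OF indep_finite[OF that(1)] that(2)] card_indep_le_rank[OF that(1)] B by simp
  then show "base M B" using B indep_subset_ground unfolding base_def basis_of_def by simp
qed

lemma base_exchange_iff:
  assumes "base M B" and "x \<in> B" and "y \<notin> B"
  shows "base M (insert y (B - {x})) \<longleftrightarrow> insert y (B - {x}) \<in> indeps M"
proof -
  have B: "finite B" "card B = rank M" using assms(1) indep_finite by (auto simp: base_iff_card)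
  have "card (insert y (B - {x})) = Suc (card (B - {x}))"
    by (rule card_insert_disjoint) (use B(1) assms(3) in auto)
  also have "\<dots> = rank M" unfolding card_Suc_Diff1[OF B(1) assms(2)] by (rule B(2))
  finally show ?thesis by (simp add: base_iff_card)
qed

text \<open>
  Independence in a contraction may be tested with any one basis \<open>B\<close> of the contracted set. Given that
  \<open>I \<union> B'\<close> is independent for another basis \<open>B'\<close>, enlarge \<open>B\<close> to the size of \<open>I \<union> B'\<close> within
  \<open>B \<union> I \<union> B'\<close>: by maximality of \<open>B\<close> in \<open>X\<close> nothing can come from \<open>B'\<close>, so all of \<open>I\<close> is added.
\<close>

lemma indeps_contract_iff:
  assumes B: "basis_of M X B"
  shows "I \<in> indeps (contract M X) \<longleftrightarrow> I \<subseteq> ground M - X \<and> I \<union> B \<in> indeps M"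
proof
  assume "I \<in> indeps (contract M X)"
  then obtain B' where B': "basis_of M X B'" and I: "I \<subseteq> ground M - X" "I \<union> B' \<in> indeps M"
    unfolding contract_def by auto
  have ind: "B \<in> indeps M" "B \<subseteq> X" "B' \<in> indeps M" "B' \<subseteq> X"
    and max: "\<And>J. J \<in> indeps M \<Longrightarrow> B \<subseteq> J \<Longrightarrow> J \<subseteq> X \<Longrightarrow> J = B"
    using B B' unfolding basis_of_def by simp_all
  have dep: "insert x A \<notin> indeps M" if "basis_of M X A" "x \<in> X - A" for x A
  proof
    assume "insert x A \<in> indeps M"
    moreover have "A \<subseteq> insert x A" "insert x A \<subseteq> X" using that unfolding basis_of_def by auto
    ultimately have "insert x A = A" using that(1) unfolding basis_of_def by simp
    then show False using that(2) by blast
  qed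
  have "card B \<le> card B'" "card B' \<le> card B"
    using card_indep_le_card_spanning[OF ind(3,1)] card_indep_le_card_spanning[OF ind(1,3)]
      dep[OF B] dep[OF B'] ind(2,4) by blast+
  then have cards: "card (I \<union> B) = card (I \<union> B')"
    using I ind(2,4) indep_finite[OF ind(1)] indep_finite[OF I(2)]
    by (subst (1 2) card_Un_disjoint) auto
  moreover have "card B \<le> card (I \<union> B)"
    using indep_finite[OF ind(1)] indep_finite[OF I(2)] by (intro card_mono) auto
  ultimately obtain K where K: "K \<in> indeps M" "B \<subseteq> K" "K \<subseteq> B \<union> (I \<union> B')" "card K = card (I \<union> B')"
    using indep_extend[OF ind(1) I(2)] by auto
  have "K \<inter> X = B" using K ind(2) by (intro max indep_hereditary[OF K(1)]) auto
  then have "K \<subseteq> I \<union> B" using K(3) ind(4) by blast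
  moreover have "finite (I \<union> B)" using indep_finite[OF ind(1)] indep_finite[OF I(2)] by simp
  ultimately have "K = I \<union> B" using cards K(4) by (metis card_subset_eq)
  then show "I \<subseteq> ground M - X \<and> I \<union> B \<in> indeps M" using I(1) K(1) by simp
next
  assume "I \<subseteq> ground M - X \<and> I \<union> B \<in> indeps M"
  then show "I \<in> indeps (contract M X)" using B unfolding contract_def by auto
qed

section \<open>A minor M(K4) obstructs base-orderability\<close>

text \<open>
  The minor is obtained by contraction of \<open>C\<close> and deletion of \<open>D\<close>, so independence of \<open>J\<close> in it is
  independence of \<open>J \<union> I0\<close> in \<open>M\<close>, for a basis \<open>I0\<close> of \<open>C\<close>. The deletion may drop the rank, hence
  \<open>{x1, x2, x3} \<union> I0\<close> and \<open>{y1, y2, y3} \<union> I0\<close> need not be bases of \<open>M\<close>, but they have the same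
  closure and so can be completed in the same way.
\<close>

lemma not_base_orderable_if_K4_minor:
  assumes "minor N M" and "matroid_isomorphic N (cycle_matroid (complete_graph 4))"
  shows "\<not> base_orderable M"
proof
  assume ord: "base_orderable M"
  obtain x1 x2 x3 y1 y2 y3 where dist: "distinct [x1, x2, x3, y1, y2, y3]"
    and gr: "ground N = {x1, x2, x3, y1, y2, y3}"
    and circ: "\<forall>I \<subseteq> ground N. I \<in> indeps N \<longleftrightarrow> (\<forall>C \<in> K4_circuits x1 x2 x3 y1 y2 y3. \<not> C \<subseteq> I)"
    using assms(2) unfolding isomorphic_M_K4_iff by (elim exE conjE)
  have "distinct [y3, y2, y1, x3, x2, x1]" using dist by auto
  note d = dist this
  let ?A1 = "{x1, x2, x3}" and ?A2 = "{y1, y2, y3}"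
  have A: "?A1 \<subseteq> ground N" "?A2 \<subseteq> ground N" "?A1 \<inter> ?A2 = {}" using d unfolding gr by auto
  have A_ind: "?A1 \<in> indeps N" "?A2 \<in> indeps N"
    using circ A(1,2) d by (simp_all add: K4_circuits_def)
  have line: "T \<notin> indeps N" if "C \<in> K4_circuits x1 x2 x3 y1 y2 y3" "C \<subseteq> T" "T \<subseteq> ground N" for C T
    using that circ by blast
  have "insert y1 ?A1 \<notin> indeps N"
    by (rule line[of "{x2, x3, y1}"]) (simp_all add: gr K4_circuits_def)
  moreover have "insert y2 ?A1 \<notin> indeps N"
    by (rule line[of "{x1, x3, y2}"]) (simp_all add: gr K4_circuits_def)
  moreover have "insert y3 ?A1 \<notin> indeps N"
    by (rule line[of "{x1, x2, x3, y3}"]) (simp_all add: gr K4_circuits_def)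
  ultimately have A1_max: "insert y ?A1 \<notin> indeps N" if "y \<in> ?A2" for y
    using that by (elim insertE emptyE) simp_all
  have "insert x1 ?A2 \<notin> indeps N"
    by (rule line[of "{x1, y1, y3}"]) (simp_all add: gr K4_circuits_def)
  moreover have "insert x2 ?A2 \<notin> indeps N"
    by (rule line[of "{x2, y2, y3}"]) (simp_all add: gr K4_circuits_def)
  moreover have "insert x3 ?A2 \<notin> indeps N"
    by (rule line[of "{x3, y3, y1, y2}"]) (simp_all add: gr K4_circuits_def)
  ultimately have A2_max: "insert x ?A2 \<notin> indeps N" if "x \<in> ?A1" for x
    using that by (elim insertE emptyE) simp_all
  obtain C D where N: "N = delete (contract M C) D"
    using assms(1) unfolding minor_def by blast
  obtain I0 where I0: "basis_of M C I0"
    using A_ind(1) unfolding N delete_def contract_def by auto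
  have grN: "ground N = ground M - C - D" by (simp add: N delete_def contract_def)
  have indN: "J \<in> indeps N \<longleftrightarrow> J \<union> I0 \<in> indeps M" if "J \<subseteq> ground N" for J
    using that indeps_contract_iff[OF I0, of J] unfolding grN by (auto simp: N delete_def contract_def)
  have I0A: "I0 \<inter> ground N = {}" using I0 unfolding grN basis_of_def by auto
  \<comment> \<open>A basis \<open>B1\<close> of \<open>M\<close> above the first triple; the second triple is then completed with elements of
    \<open>B1\<close>. As both triples are maximal independent in \<open>N\<close>, neither basis can meet the other's triple, so
    the two bases agree outside the triples.\<close>
  obtain B0 where B0: "B0 \<in> indeps M" "card B0 = rank M" using indep_of_full_rank by blast
  have A1I: "?A1 \<union> I0 \<in> indeps M" and A2I: "?A2 \<union> I0 \<in> indeps M"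
    using A_ind indN A by blast+
  obtain B1 where B1: "B1 \<in> indeps M" "?A1 \<union> I0 \<subseteq> B1" "card B1 = rank M"
    using indep_extend[OF A1I B0(1)] card_indep_le_rank[OF A1I] B0(2) by auto
  obtain B2 where B2: "B2 \<in> indeps M" "?A2 \<union> I0 \<subseteq> B2" "B2 \<subseteq> ?A2 \<union> I0 \<union> B1" "card B2 = rank M"
    using indep_extend[OF A2I B1(1)] card_indep_le_rank[OF A2I] B1(3) by auto
  have disj1: "y \<notin> B1" if y: "y \<in> ?A2" for y
  proof
    assume "y \<in> B1"
    then have "insert y ?A1 \<union> I0 \<in> indeps M" using B1 by (intro indep_hereditary[OF B1(1)]) auto
    moreover have "insert y ?A1 \<subseteq> ground N" using y A by blast
    ultimately show False using indN A1_max[OF y] by blast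
  qed
  have disj2: "x \<notin> B2" if x: "x \<in> ?A1" for x
  proof
    assume "x \<in> B2"
    then have "insert x ?A2 \<union> I0 \<in> indeps M" using B2 by (intro indep_hereditary[OF B2(1)]) auto
    moreover have "insert x ?A2 \<subseteq> ground N" using x A by blast
    ultimately show False using indN A2_max[OF x] by blast
  qed
  have base: "base M B1" "base M B2" using B1 B2 by (simp_all add: base_iff_card)
  have "B2 - ?A2 \<subseteq> B1 - ?A1" using B2(3) B1(2) disj2 by blast
  moreover have "card (B2 - ?A2) = card (B1 - ?A1)"
  proof -
    have "card (B1 - ?A1) = card B1 - card ?A1" by (rule card_Diff_subset) (use B1(2) in auto)
    moreover have "card (B2 - ?A2) = card B2 - card ?A2" by (rule card_Diff_subset) (use B2(2) in auto)
    ultimately show ?thesis using B1(3) B2(4) d by simp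
  qed
  ultimately have rest: "B2 - ?A2 = B1 - ?A1"
    using indep_finite[OF B1(1)] by (intro card_subset_eq) simp_all
  obtain \<sigma> where \<sigma>: "bij_betw \<sigma> B1 B2"
    and exch: "\<And>x. x \<in> B1 \<Longrightarrow> base M ((B1 - {x}) \<union> {\<sigma> x}) \<and> base M ((B2 - {\<sigma> x}) \<union> {x})"
    using ord base unfolding base_orderable_def by blast
  \<comment> \<open>An exchange in \<open>M\<close> of an element of the first triple restricts to an exchange in \<open>N\<close>: a common
    element of the bases cannot be its partner, since then \<open>B1\<close> would just lose an element.\<close>
  have ex: "\<sigma> x \<in> ?A2 \<and> insert (\<sigma> x) (?A1 - {x}) \<in> indeps N \<and> insert x (?A2 - {\<sigma> x}) \<in> indeps N"
    if x: "x \<in> ?A1" for x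
  proof -
    have xB1: "x \<in> B1" using x B1(2) by blast
    have sB2: "\<sigma> x \<in> B2" using \<sigma> xB1 by (rule bij_betwE[THEN bspec])
    have xB2: "x \<notin> B2" using disj2[OF x] .
    have b: "base M (insert (\<sigma> x) (B1 - {x}))" "base M (insert x (B2 - {\<sigma> x}))"
      using exch[OF xB1] by simp_all
    have "\<sigma> x \<notin> B1"
    proof
      assume "\<sigma> x \<in> B1"
      then have "insert (\<sigma> x) (B1 - {x}) = B1 - {x}" using sB2 xB2 by auto
      then have "card (B1 - {x}) = card B1" using b(1) B1(3) by (simp add: base_iff_card)
      then show False using card_Diff1_less[OF indep_finite[OF B1(1)] xB1] by simp
    qed
    then have s: "\<sigma> x \<in> ?A2" using sB2 rest by blast
    have "insert (\<sigma> x) (?A1 - {x}) \<union> I0 \<subseteq> insert (\<sigma> x) (B1 - {x})"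
      using B1(2) I0A A(1) x by blast
    then have "insert (\<sigma> x) (?A1 - {x}) \<union> I0 \<in> indeps M"
      using b(1) indep_hereditary unfolding base_iff_card by blast
    moreover have "insert x (?A2 - {\<sigma> x}) \<union> I0 \<subseteq> insert x (B2 - {\<sigma> x})"
      using B2(2) I0A A(2) s by blast
    then have "insert x (?A2 - {\<sigma> x}) \<union> I0 \<in> indeps M"
      using b(2) indep_hereditary unfolding base_iff_card by blast
    moreover have "insert (\<sigma> x) (?A1 - {x}) \<subseteq> ground N" "insert x (?A2 - {\<sigma> x}) \<subseteq> ground N"
      using A s x by blast+
    ultimately show ?thesis using s indN by simp
  qed
  \<comment> \<open>The four triangles forbid all exchanges between \<open>{x1, x2}\<close> and \<open>{y1, y2}\<close>.\<close>
  have "\<sigma> x1 = y3"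
  proof -
    have "insert y1 (?A1 - {x1}) \<notin> indeps N"
      by (rule line[of "{x2, x3, y1}"]) (use d in \<open>simp_all add: gr K4_circuits_def insert_Diff_if\<close>)
    then have "\<sigma> x1 \<noteq> y1" using ex[of x1] by auto
    moreover have "insert x1 (?A2 - {y2}) \<notin> indeps N"
      by (rule line[of "{x1, y1, y3}"]) (use d in \<open>simp_all add: gr K4_circuits_def insert_Diff_if\<close>)
    then have "\<sigma> x1 \<noteq> y2" using ex[of x1] by auto
    ultimately show ?thesis using ex[of x1] by simp
  qed
  moreover have "\<sigma> x2 = y3"
  proof -
    have "insert y2 (?A1 - {x2}) \<notin> indeps N"
      by (rule line[of "{x1, x3, y2}"]) (use d in \<open>simp_all add: gr K4_circuits_def insert_Diff_if\<close>)
    then have "\<sigma> x2 \<noteq> y2" using ex[of x2] by auto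
    moreover have "insert x2 (?A2 - {y1}) \<notin> indeps N"
      by (rule line[of "{x2, y2, y3}"]) (use d in \<open>simp_all add: gr K4_circuits_def insert_Diff_if\<close>)
    then have "\<sigma> x2 \<noteq> y1" using ex[of x2] by auto
    ultimately show ?thesis using ex[of x2] by simp
  qed
  moreover have "x1 \<in> B1" "x2 \<in> B1" using B1(2) by auto
  ultimately show False using bij_betw_imp_inj_on[OF \<sigma>] d by (auto dest: inj_onD)
qed

section \<open>Exchanges in paving matroids\<close>

lemma dependent_contains_circuit:
  assumes "S \<subseteq> ground M" and "S \<notin> indeps M"
  shows "\<exists>C. circuit M C \<and> C \<subseteq> S"
  using finite_subset[OF assms(1) finite_ground] assms
proof (induction S rule: finite_psubset_induct)
  case (psubset S)
  show ?case
  proof (cases "\<exists>D. D \<subset> S \<and> D \<notin> indeps M")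
    case True
    then obtain D where D: "D \<subset> S" "D \<notin> indeps M" by blast
    then obtain C where "circuit M C" "C \<subseteq> D" using psubset.IH[OF D(1)] psubset.prems by blast
    then show ?thesis using D(1) by blast
  next
    case False
    then have "circuit M S" using psubset.prems unfolding circuit_def by blast
    then show ?thesis by blast
  qed
qed

lemma paving_indep:
  assumes "paving M" and S: "S \<subseteq> ground M" and "card S < rank M"
  shows "S \<in> indeps M"
proof (rule ccontr)
  assume "S \<notin> indeps M"
  then obtain C where C: "circuit M C" "C \<subseteq> S" using dependent_contains_circuit[OF S] by blast
  then have "card C \<le> card S" using finite_subset[OF S finite_ground] by (intro card_mono)
  then show False using assms(1,3) C(1) unfolding paving_def by auto
qed

text \<open>
  If both exchanges fail, the set \<open>B - {x, x'} + y\<close>, which is independent because it is smaller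
  than the rank, has \<open>x\<close> and \<open>x'\<close> and hence all of \<open>B\<close> in its closure.
\<close>

lemma paving_blocked_unique:
  assumes pav: "paving M" and B: "base M B" and y: "y \<in> ground M - B"
    and xs: "x \<in> B" "x' \<in> B"
    and dep: "insert y (B - {x}) \<notin> indeps M" "insert y (B - {x'}) \<notin> indeps M"
  shows "x = x'"
proof (rule ccontr)
  assume ne: "x \<noteq> x'"
  have ind: "B \<in> indeps M" and cB: "card B = rank M" using B by (simp_all add: base_iff_card)
  have fin: "finite B" using indep_finite[OF ind] .
  have sub: "B \<subseteq> ground M" using indep_subset_ground[OF ind] .
  define S where "S = insert y (B - {x, x'})"
  have "card (B - {x, x'}) = card B - 2"
    using card_Diff_subset[of "{x, x'}" B] xs ne by simp
  moreover have "card B \<ge> 2" using card_mono[OF fin, of "{x, x'}"] xs ne by simp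
  ultimately have cS: "Suc (card S) = rank M"
    unfolding S_def using fin y cB by simp
  have "S \<in> indeps M" using sub y cS unfolding S_def by (intro paving_indep[OF pav]) auto
  moreover have "insert z S \<notin> indeps M" if z: "z \<in> B - S" for z
  proof -
    consider "z = x" | "z = x'" using z unfolding S_def by blast
    then show ?thesis
    proof cases
      case 1
      then have "insert z S = insert y (B - {x'})" unfolding S_def using xs ne by blast
      then show ?thesis using dep(2) by simp
    next
      case 2
      then have "insert z S = insert y (B - {x})" unfolding S_def using xs ne by blast
      then show ?thesis using dep(1) by simp
    qed
  qed
  ultimately have "card B \<le> card S" using card_indep_le_card_spanning[OF _ ind] by blast
  then show False using cS cB by simp
qed

text \<open>
  Some \<open>y\<close> can replace \<open>x\<close> in \<open>B1\<close>. If \<open>x\<close> cannot replace \<open>y\<close> in \<open>B2\<close>, it can replace every other element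
  of \<open>B2\<close> by uniqueness,
  so under the contrary assumption \<open>y\<close> is the only element of \<open>B2\<close> outside the hyperplane spanned by
  \<open>B1 - x\<close>. That hyperplane is then also spanned by \<open>B2 - y\<close>. As \<open>x\<close> lies in the closure of
  \<open>B2 - y\<close>, so does all of \<open>B1\<close>, which is impossible.
\<close>

lemma paving_symmetric_exchange:
  assumes pav: "paving M" and B1: "base M B1" and B2: "base M B2" and x: "x \<in> B1 - B2"
  shows "\<exists>y \<in> B2 - B1. insert y (B1 - {x}) \<in> indeps M \<and> insert x (B2 - {y}) \<in> indeps M"
proof (rule ccontr)
  assume none: "\<not> ?thesis"
  have ind: "B1 \<in> indeps M" "B2 \<in> indeps M" and c: "card B1 = rank M" "card B2 = rank M"
    using B1 B2 by (simp_all add: base_iff_card)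
  have H: "B1 - {x} \<in> indeps M" using indep_hereditary[OF ind(1)] by blast
  have cH: "card (B1 - {x}) < rank M"
    unfolding c(1)[symmetric] by (rule card_Diff1_less) (use indep_finite[OF ind(1)] x in blast)+
  have xg: "x \<in> ground M - B2" using x indep_subset_ground[OF ind(1)] by blast
  have "\<exists>y \<in> B2 - (B1 - {x}). insert y (B1 - {x}) \<in> indeps M"
    using indep_augment[OF H ind(2)] cH c(2) by simp
  then obtain y where y: "y \<in> B2 - B1" "insert y (B1 - {x}) \<in> indeps M" using x by blast
  then have dep: "insert x (B2 - {y}) \<notin> indeps M" using none by blast
  have dep1: "insert z (B1 - {x}) \<notin> indeps M" if z: "z \<in> B2 - B1" "z \<noteq> y" for z
  proof
    assume "insert z (B1 - {x}) \<in> indeps M"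
    then have "insert x (B2 - {z}) \<notin> indeps M" using none z by blast
    then have "z = y" using paving_blocked_unique[OF pav B2 xg _ _ _ dep] z(1) y(1) by blast
    then show False using z(2) by simp
  qed
  have K: "B2 - {y} \<in> indeps M" using indep_hereditary[OF ind(2)] by blast
  have cK: "Suc (card (B2 - {y})) = rank M"
    unfolding c(2)[symmetric] by (rule card_Suc_Diff1) (use indep_finite[OF ind(2)] y(1) in blast)+
  have "insert z (B2 - {y}) \<notin> indeps M" if z: "z \<in> B1 - (B2 - {y})" for z
  proof (cases "z = x")
    case True
    then show ?thesis using dep by simp
  next
    case False
    have zB2: "z \<notin> B2 - {y}" using z by blast
    show ?thesis
    proof
      assume T: "insert z (B2 - {y}) \<in> indeps M"
      have "insert w (B1 - {x}) \<notin> indeps M" if w: "w \<in> insert z (B2 - {y}) - (B1 - {x})" for w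
        using w False z x dep1 by blast
      then have "card (insert z (B2 - {y})) \<le> card (B1 - {x})"
        using card_indep_le_card_spanning[OF H T] by blast
      moreover have "card (insert z (B2 - {y})) = rank M"
        using card_insert_disjoint[OF indep_finite[OF K] zB2] cK by simp
      ultimately show False using cH by simp
    qed
  qed
  then have "card B1 \<le> card (B2 - {y})" using card_indep_le_card_spanning[OF K ind(1)] by blast
  then show False using cK c(1) by simp
qed

text \<open>
  A double count of the pairs in \<open>X \<times> Y\<close>. By \<open>paving_blocked_unique\<close> at most \<open>|Y|\<close> of them are blocked
  on the side of \<open>B1\<close> and at most \<open>|X|\<close> on the side of \<open>B2\<close>, so \<open>|X| |Y| \<le> |X| + |Y|\<close>. If
  \<open>|X| = 1\<close>, the size condition forces \<open>Y = B2 - B1\<close>, against symmetric exchange, and likewise for \<open>Y\<close>.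
  The inequality then leaves only two by two.
\<close>

lemma paving_blocked_rectangle:
  assumes pav: "paving M" and B1: "base M B1" and B2: "base M B2"
    and X: "X \<subseteq> B1 - B2" and Y: "Y \<subseteq> B2 - B1" and large: "card (B1 - B2) < card X + card Y"
    and blocked: "\<And>x y. x \<in> X \<Longrightarrow> y \<in> Y \<Longrightarrow>
      insert y (B1 - {x}) \<notin> indeps M \<or> insert x (B2 - {y}) \<notin> indeps M"
  shows "card X = 2 \<and> card Y = 2"
proof -
  have ind: "B1 \<in> indeps M" "B2 \<in> indeps M" and c: "card B1 = rank M" "card B2 = rank M"
    using B1 B2 by (simp_all add: base_iff_card)
  have fin: "finite B1" "finite B2" using ind indep_finite by blast+
  have ground: "B1 \<subseteq> ground M" "B2 \<subseteq> ground M" using ind indep_subset_ground by blast+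
  have finXY: "finite X" "finite Y" using X Y fin by (meson finite_Diff finite_subset)+
  have diffs: "card (B1 - B2) = card (B2 - B1)"
  proof -
    have "card (B1 - B2) = card B1 - card (B1 \<inter> B2)" by (rule card_Diff_subset_Int) (simp add: fin)
    moreover have "card (B2 - B1) = card B2 - card (B2 \<inter> B1)"
      by (rule card_Diff_subset_Int) (simp add: fin)
    ultimately show ?thesis using c by (simp add: Int_commute)
  qed
  have leX: "card X \<le> card (B1 - B2)" using X fin by (intro card_mono) simp_all
  have leY: "card Y \<le> card (B1 - B2)" unfolding diffs using Y fin by (intro card_mono) simp_all
  have "card X \<noteq> 1"
  proof
    assume one: "card X = 1"
    then obtain x where x: "X = {x}" by (auto simp: card_1_singleton_iff)
    have "Y = B2 - B1" using Y leY large one diffs fin by (intro card_subset_eq) simp_all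
    then show False
      using paving_symmetric_exchange[OF pav B1 B2, of x] X blocked x by blast
  qed
  moreover have "card Y \<noteq> 1"
  proof
    assume one: "card Y = 1"
    then obtain y where y: "Y = {y}" by (auto simp: card_1_singleton_iff)
    have "X = B1 - B2" using X leX large one fin by (intro card_subset_eq) simp_all
    then show False
      using paving_symmetric_exchange[OF pav B2 B1, of y] Y blocked y by blast
  qed
  moreover have "card X \<noteq> 0" "card Y \<noteq> 0" using leX leY large by linarith+
  ultimately have two: "card X \<ge> 2" "card Y \<ge> 2" by linarith+
  let ?D1 = "{p \<in> X \<times> Y. insert (snd p) (B1 - {fst p}) \<notin> indeps M}"
  let ?D2 = "{p \<in> X \<times> Y. insert (fst p) (B2 - {snd p}) \<notin> indeps M}"
  have "inj_on snd ?D1"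
  proof (rule inj_onI)
    fix p q assume pq: "p \<in> ?D1" "q \<in> ?D1" "snd p = snd q"
    have "fst p = fst q"
      using pq X Y ground by (intro paving_blocked_unique[OF pav B1, of "snd p"]) auto
    then show "p = q" using pq(3) by (simp add: prod_eq_iff)
  qed
  then have D1: "card ?D1 \<le> card Y" by (rule card_inj_on_le) (use finXY in auto)
  have "inj_on fst ?D2"
  proof (rule inj_onI)
    fix p q assume pq: "p \<in> ?D2" "q \<in> ?D2" "fst p = fst q"
    have "snd p = snd q"
      using pq X Y ground by (intro paving_blocked_unique[OF pav B2, of "fst p"]) auto
    then show "p = q" using pq(3) by (simp add: prod_eq_iff)
  qed
  then have D2: "card ?D2 \<le> card X" by (rule card_inj_on_le) (use finXY in auto)
  have "X \<times> Y = ?D1 \<union> ?D2" using blocked by force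
  then have "card X * card Y = card (?D1 \<union> ?D2)" using card_cartesian_product[of X Y] by simp
  also have "\<dots> \<le> card ?D1 + card ?D2" by (rule card_Un_le)
  also have "\<dots> \<le> card X + card Y" using D1 D2 by simp
  finally have le: "card X * card Y \<le> card X + card Y" .
  obtain m n where "card X = 2 + m" "card Y = 2 + n" using two le_Suc_ex by metis
  then show ?thesis using le by (simp add: algebra_simps)
qed

section \<open>From a blocked rectangle to the complete quadrilateral\<close>

text \<open>
  In the contraction by \<open>P\<close>, which has rank three, two points span a line: if \<open>a, b, c\<close> were
  collinear and \<open>a, b, e\<close> too, then \<open>a, c, e\<close> would be as well.
\<close>

lemma paving_triple_exchange:
  assumes pav: "paving M" and rank: "card P + 3 = rank M" and P: "P \<subseteq> ground M"
    and sub: "{a, b, c, e} \<subseteq> ground M - P" and dist: "distinct [a, b, c, e]"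
    and ace: "P \<union> {a, c, e} \<in> indeps M" and abc: "P \<union> {a, b, c} \<notin> indeps M"
  shows "P \<union> {a, b, e} \<in> indeps M"
proof (rule ccontr)
  assume abe: "P \<union> {a, b, e} \<notin> indeps M"
  have card: "card (P \<union> T) = card P + card T" if "finite T" "T \<subseteq> ground M - P" for T
    using that finite_subset[OF P finite_ground] by (intro card_Un_disjoint) auto
  have ab: "card (P \<union> {a, b}) = card P + 2" using card[of "{a, b}"] sub dist by simp
  have "P \<union> {a, b} \<subseteq> ground M" using P sub by blast
  then have S: "P \<union> {a, b} \<in> indeps M" using ab rank by (intro paving_indep[OF pav]) simp_all
  have "insert z (P \<union> {a, b}) \<notin> indeps M" if "z \<in> (P \<union> {a, c, e}) - (P \<union> {a, b})" for z
  proof -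
    have "z = c \<or> z = e" using that by blast
    moreover have "insert c (P \<union> {a, b}) = P \<union> {a, b, c}" "insert e (P \<union> {a, b}) = P \<union> {a, b, e}"
      by blast+
    ultimately show ?thesis using abc abe by (elim disjE) simp_all
  qed
  then have "card (P \<union> {a, c, e}) \<le> card (P \<union> {a, b})"
    using card_indep_le_card_spanning[OF S ace] by blast
  moreover have "card (P \<union> {a, c, e}) = card P + 3" using card[of "{a, c, e}"] sub dist by simp
  ultimately show False using ab by simp
qed

text \<open>
  Two bases and four lines determine the matroid on the six points. Every further triple that should be
  a base shares two points with one of the lines and is reached from a triple already known to be
  independent in one application of \<open>paving_triple_exchange\<close>.
\<close>

lemma K4_minor_if_quadrilateral:
  assumes pav: "paving M" and dist: "distinct [x1, x2, x3, y1, y2, y3]"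
    and P: "P \<subseteq> ground M" and Q: "{x1, x2, x3, y1, y2, y3} \<subseteq> ground M - P"
    and rank: "card P + 3 = rank M"
    and ind: "P \<union> {x1, x2, x3} \<in> indeps M" "P \<union> {y1, y2, y3} \<in> indeps M"
    and dep: "P \<union> {x2, x3, y1} \<notin> indeps M" "P \<union> {x1, x3, y2} \<notin> indeps M"
      "P \<union> {x2, y2, y3} \<notin> indeps M" "P \<union> {x1, y1, y3} \<notin> indeps M"
  shows "\<exists>N. minor N M \<and> matroid_isomorphic N (cycle_matroid (complete_graph 4))"
proof -
  let ?Q = "{x1, x2, x3, y1, y2, y3}"
  have "distinct [y3, y2, y1, x3, x2, x1]" using dist by auto
  note d = dist this
  have finP: "finite P" using P finite_ground by (rule finite_subset)
  have exchange: "P \<union> {a, b, e} \<in> indeps M"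
    if "distinct [a, b, c, e]" "{a, b, c, e} \<subseteq> ground M - P"
      "P \<union> {a, c, e} \<in> indeps M" "P \<union> {a, b, c} \<notin> indeps M" for a b c e
    using paving_triple_exchange[OF pav rank P that(2,1,3,4)] .
  \<comment> \<open>In \<open>exchange[of a b c e]\<close> the line is \<open>{a, b, c}\<close>, the known independent triple \<open>{a, c, e}\<close>
    and the new one \<open>{a, b, e}\<close>.\<close>
  have i1: "P \<union> {x1, x2, y1} \<in> indeps M"
    using exchange[of x2 y1 x3 x1] ind dep d Q by (simp add: insert_commute)
  have i2: "P \<union> {x1, x2, y2} \<in> indeps M"
    using exchange[of x1 y2 x3 x2] ind dep d Q by (simp add: insert_commute)
  have i3: "P \<union> {x1, x3, y1} \<in> indeps M"
    using exchange[of x3 y1 x2 x1] ind dep d Q by (simp add: insert_commute)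
  have i4: "P \<union> {x2, x3, y2} \<in> indeps M"
    using exchange[of x3 y2 x1 x2] ind dep d Q by (simp add: insert_commute)
  have i5: "P \<union> {x1, y1, y2} \<in> indeps M"
    using exchange[of y1 x1 y3 y2] ind dep d Q by (simp add: insert_commute)
  have i6: "P \<union> {x2, y1, y2} \<in> indeps M"
    using exchange[of y2 x2 y3 y1] ind dep d Q by (simp add: insert_commute)
  have i7: "P \<union> {x2, y1, y3} \<in> indeps M"
    using exchange[of y3 x2 y2 y1] ind dep d Q by (simp add: insert_commute)
  have i8: "P \<union> {x1, y2, y3} \<in> indeps M"
    using exchange[of y3 x1 y1 y2] ind dep d Q by (simp add: insert_commute)
  have i9: "P \<union> {x1, x2, y3} \<in> indeps M"
    using exchange[of y3 x2 y2 x1] i8 dep d Q by (simp add: insert_commute)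
  have i10: "P \<union> {x1, x3, y3} \<in> indeps M"
    using exchange[of x1 y3 y1 x3] i3 dep d Q by (simp add: insert_commute)
  have i11: "P \<union> {x2, x3, y3} \<in> indeps M"
    using exchange[of x2 y3 y2 x3] i4 dep d Q by (simp add: insert_commute)
  have i12: "P \<union> {x3, y1, y2} \<in> indeps M"
    using exchange[of y1 x3 x2 y2] i6 dep d Q by (simp add: insert_commute)
  have i13: "P \<union> {x3, y1, y3} \<in> indeps M"
    using exchange[of y1 x3 x2 y3] i7 dep d Q by (simp add: insert_commute)
  have i14: "P \<union> {x3, y2, y3} \<in> indeps M"
    using exchange[of y2 y3 x2 x3] i4 dep d Q by (simp add: insert_commute)
  have bases: "P \<union> B \<in> indeps M" if "B \<in> K4_bases x1 x2 x3 y1 y2 y3" for B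
    using that ind i1 i2 i3 i4 i5 i6 i7 i8 i9 i10 i11 i12 i13 i14 unfolding K4_bases_def
    by (elim insertE emptyE) (simp_all only:)
  have four: "P \<union> {a, b, c, e} \<notin> indeps M" if "distinct [a, b, c, e]" "{a, b, c, e} \<subseteq> ground M - P" for a b c e
  proof
    assume "P \<union> {a, b, c, e} \<in> indeps M"
    then have "card (P \<union> {a, b, c, e}) \<le> rank M" by (rule card_indep_le_rank)
    moreover have "card (P \<union> {a, b, c, e}) = card P + card {a, b, c, e}"
      using that(2) finP by (intro card_Un_disjoint) auto
    ultimately show False using that(1) rank by simp
  qed
  have "P \<union> {x3, y3, y1, y2} \<notin> indeps M" "P \<union> {x1, x2, y1, y2} \<notin> indeps M"
    "P \<union> {x1, x2, x3, y3} \<notin> indeps M" by (rule four; use d Q in simp)+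
  then have circuits: "P \<union> C \<notin> indeps M" if "C \<in> K4_circuits x1 x2 x3 y1 y2 y3" for C
    using that dep unfolding K4_circuits_def by (elim insertE emptyE) (simp_all only: not_False_eq_True)
  define N where "N = delete (contract M P) (ground M - P - ?Q)"
  have "minor N M"
    unfolding minor_def N_def using P
    by (intro exI[of _ P] exI[of _ "ground M - P - ?Q"]) auto
  moreover have grN: "ground N = ?Q"
    using Q by (auto simp: N_def delete_def contract_def)
  moreover have "J \<in> indeps N \<longleftrightarrow> (\<forall>C \<in> K4_circuits x1 x2 x3 y1 y2 y3. \<not> C \<subseteq> J)" if J: "J \<subseteq> ?Q" for J
  proof -
    have "P \<in> indeps M" using indep_hereditary[OF ind(1)] by blast
    then have "basis_of M P P" by (auto simp: basis_of_def)
    then have "J \<in> indeps N \<longleftrightarrow> P \<union> J \<in> indeps M"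
      using indeps_contract_iff[of P P J] J Q by (auto simp: N_def delete_def contract_def Un_commute)
    also have "\<dots> \<longleftrightarrow> (\<forall>C \<in> K4_circuits x1 x2 x3 y1 y2 y3. \<not> C \<subseteq> J)"
    proof
      assume PJ: "P \<union> J \<in> indeps M"
      show "\<forall>C \<in> K4_circuits x1 x2 x3 y1 y2 y3. \<not> C \<subseteq> J"
      proof (intro ballI notI)
        fix C assume C: "C \<in> K4_circuits x1 x2 x3 y1 y2 y3" "C \<subseteq> J"
        have "P \<union> C \<in> indeps M" using indep_hereditary[OF PJ] C(2) by blast
        then show False using circuits[OF C(1)] by simp
      qed
    next
      assume "\<forall>C \<in> K4_circuits x1 x2 x3 y1 y2 y3. \<not> C \<subseteq> J"
      then obtain B where B: "B \<in> K4_bases x1 x2 x3 y1 y2 y3" "J \<subseteq> B"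
        using K4_indep_subset_base[OF J] by blast
      show "P \<union> J \<in> indeps M" using indep_hereditary[OF bases[OF B(1)]] B(2) by blast
    qed
    finally show ?thesis .
  qed
  then have "matroid_isomorphic N (cycle_matroid (complete_graph 4))"
    unfolding isomorphic_M_K4_iff grN using dist
    by (intro exI[of _ x1] exI[of _ x2] exI[of _ x3] exI[of _ y1] exI[of _ y2] exI[of _ y3] conjI) simp_all
  ultimately show ?thesis by blast
qed

text \<open>
  Here \<open>y1\<close> lies in the hyperplane spanned by \<open>B1 - x1\<close>. By \<open>paving_blocked_unique\<close> it is not in that of
  \<open>B1 - x2\<close>, so the pair \<open>(x2, y1)\<close> must be blocked on the side of \<open>B2\<close>, hence \<open>(x2, y2)\<close> on the
  side of \<open>B1\<close>, hence \<open>(x1, y2)\<close> on the side of \<open>B2\<close>. These four dependent sets are the lines of the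
  quadrilateral.
\<close>

lemma K4_minor_if_blocked_square:
  assumes pav: "paving M" and B1: "base M B1" and B2: "base M B2"
    and small: "card (B1 - B2) \<le> 3"
    and x: "x1 \<in> B1 - B2" "x2 \<in> B1 - B2" "x1 \<noteq> x2"
    and y: "y1 \<in> B2 - B1" "y2 \<in> B2 - B1" "y1 \<noteq> y2"
    and blocked: "\<And>x y. x \<in> {x1, x2} \<Longrightarrow> y \<in> {y1, y2} \<Longrightarrow>
      insert y (B1 - {x}) \<notin> indeps M \<or> insert x (B2 - {y}) \<notin> indeps M"
    and start: "insert y1 (B1 - {x1}) \<notin> indeps M"
  shows "\<exists>N. minor N M \<and> matroid_isomorphic N (cycle_matroid (complete_graph 4))"
proof -
  have ind: "B1 \<in> indeps M" "B2 \<in> indeps M" and c: "card B1 = rank M" "card B2 = rank M"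
    using B1 B2 by (simp_all add: base_iff_card)
  have fin: "finite B1" "finite B2" using ind indep_finite by blast+
  have ground: "B1 \<subseteq> ground M" "B2 \<subseteq> ground M" using ind indep_subset_ground by blast+
  have uniq1: "a = b" if "e \<in> B2 - B1" "a \<in> B1" "b \<in> B1"
      "insert e (B1 - {a}) \<notin> indeps M" "insert e (B1 - {b}) \<notin> indeps M" for a b e
    using that ground by (intro paving_blocked_unique[OF pav B1, of e]) auto
  have uniq2: "a = b" if "e \<in> B1 - B2" "a \<in> B2" "b \<in> B2"
      "insert e (B2 - {a}) \<notin> indeps M" "insert e (B2 - {b}) \<notin> indeps M" for a b e
    using that ground by (intro paving_blocked_unique[OF pav B2, of e]) auto
  have d1: "insert x2 (B2 - {y1}) \<notin> indeps M"
    using blocked[of x2 y1] uniq1[of y1 x1 x2] start x y by blast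
  have d2: "insert y2 (B1 - {x2}) \<notin> indeps M"
    using blocked[of x2 y2] uniq2[of x2 y1 y2] d1 x y by blast
  have d3: "insert x1 (B2 - {y2}) \<notin> indeps M"
    using blocked[of x1 y2] uniq1[of y2 x1 x2] d2 x y by blast
  define P where "P = B1 \<inter> B2"
  have finP: "finite P" unfolding P_def using fin by simp
  have card1: "card B1 = card P + card (B1 - B2)"
    using card_Int_Diff[OF fin(1), of B2] unfolding P_def .
  have card2: "card B2 = card P + card (B2 - B1)"
    using card_Int_Diff[OF fin(2), of B1] unfolding P_def Int_commute[of B1] .
  have same: "card (B2 - B1) = card (B1 - B2)" using card1 card2 c by simp
  \<comment> \<open>If the bases differ in two elements only, \<open>x2\<close> is parallel to both \<open>y1\<close> and \<open>y2\<close> after contraction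
    of \<open>P\<close>, but \<open>y1\<close> and \<open>y2\<close> are independent there.\<close>
  have "card {x1, x2} \<le> card (B1 - B2)" using x fin by (intro card_mono) auto
  then have "card (B1 - B2) \<ge> 2" using x(3) by simp
  moreover have "card (B1 - B2) \<noteq> 2"
  proof
    assume two: "card (B1 - B2) = 2"
    have "{x1, x2} = B1 - B2" using x fin two by (intro card_subset_eq) auto
    then have E1: "B1 = P \<union> {x1, x2}" unfolding P_def by blast
    have "{y1, y2} = B2 - B1" using y fin two same by (intro card_subset_eq) auto
    then have E2: "B2 = P \<union> {y1, y2}" unfolding P_def by blast
    have S: "insert x2 P \<in> indeps M" using indep_hereditary[OF ind(1)] E1 by blast
    have "insert z (insert x2 P) \<notin> indeps M" if "z \<in> B2 - insert x2 P" for z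
    proof -
      have "insert y1 (B1 - {x1}) = insert y1 (insert x2 P)" "insert x2 (B2 - {y1}) = insert y2 (insert x2 P)"
        using E1 E2 x y by blast+
      moreover have "z = y1 \<or> z = y2" using that E2 by blast
      ultimately show ?thesis using start d1 by auto
    qed
    then have "card B2 \<le> card (insert x2 P)" using card_indep_le_card_spanning[OF S ind(2)] by blast
    moreover have "card (insert x2 P) \<le> Suc (card P)" by (rule card_insert_le_m1) simp_all
    ultimately show False using card2 two same by simp
  qed
  ultimately have three: "card (B1 - B2) = 3" using small by linarith
  have "card (B1 - B2 - {x1, x2}) = 1"
    using card_Diff_subset[of "{x1, x2}" "B1 - B2"] x three by simp
  then obtain x3 where x3: "B1 - B2 - {x1, x2} = {x3}" by (auto simp: card_1_singleton_iff)
  have "card (B2 - B1 - {y1, y2}) = 1"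
    using card_Diff_subset[of "{y1, y2}" "B2 - B1"] y three same by simp
  then obtain y3 where y3: "B2 - B1 - {y1, y2} = {y3}" by (auto simp: card_1_singleton_iff)
  have x3': "x3 \<in> B1 - B2" "x3 \<noteq> x1" "x3 \<noteq> x2" using x3 by blast+
  have y3': "y3 \<in> B2 - B1" "y3 \<noteq> y1" "y3 \<noteq> y2" using y3 by blast+
  have E1: "B1 = P \<union> {x1, x2, x3}" using x x3 unfolding P_def by blast
  have E2: "B2 = P \<union> {y1, y2, y3}" using y y3 unfolding P_def by blast
  have lines: "insert y1 (B1 - {x1}) = P \<union> {x2, x3, y1}" "insert y2 (B1 - {x2}) = P \<union> {x1, x3, y2}"
    "insert x2 (B2 - {y1}) = P \<union> {x2, y2, y3}" "insert x1 (B2 - {y2}) = P \<union> {x1, y1, y3}"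
    using x y x3' y3' unfolding E1 E2 by blast+
  show ?thesis
  proof (rule K4_minor_if_quadrilateral[OF pav])
    show "distinct [x1, x2, x3, y1, y2, y3]" using x y x3' y3' by auto
    show "P \<subseteq> ground M" using ground unfolding P_def by blast
    show "{x1, x2, x3, y1, y2, y3} \<subseteq> ground M - P" using x y x3' y3' ground unfolding P_def by blast
    show "card P + 3 = rank M" using card1 three c by simp
    show "P \<union> {x1, x2, x3} \<in> indeps M" "P \<union> {y1, y2, y3} \<in> indeps M" using ind E1 E2 by simp_all
    show "P \<union> {x2, x3, y1} \<notin> indeps M" "P \<union> {x1, x3, y2} \<notin> indeps M"
      "P \<union> {x2, y2, y3} \<notin> indeps M" "P \<union> {x1, y1, y3} \<notin> indeps M"
      using start d2 d1 d3 unfolding lines .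
  qed
qed

text \<open>
  Hall's theorem for the sets \<open>A x\<close> of admissible partners. The elements of \<open>B2 - B1\<close> that are partners
  of no member of a deficient set \<open>X\<close> form the other side \<open>Y\<close> of the blocked rectangle.
\<close>

lemma K4_minor_if_not_base_orderable:
  assumes pav: "paving M" and "\<not> base_orderable M"
  shows "\<exists>N. minor N M \<and> matroid_isomorphic N (cycle_matroid (complete_graph 4))"
proof -
  obtain B1 B2 where B1: "base M B1" and B2: "base M B2"
    and none: "\<And>\<sigma>. bij_betw \<sigma> B1 B2 \<Longrightarrow>
      \<not> (\<forall>x\<in>B1. base M ((B1 - {x}) \<union> {\<sigma> x}) \<and> base M ((B2 - {\<sigma> x}) \<union> {x}))"
    using assms(2) unfolding base_orderable_def by blast
  have ind: "B1 \<in> indeps M" "B2 \<in> indeps M" and c: "card B1 = card B2"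
    using B1 B2 by (simp_all add: base_iff_card)
  have fin: "finite B1" "finite B2" using ind indep_finite by blast+
  have same: "card (B1 - B2) = card (B2 - B1)"
    using card_Int_Diff[OF fin(1), of B2] card_Int_Diff[OF fin(2), of B1] c
    by (simp add: Int_commute)
  define A where "A x = {y \<in> B2 - B1. insert y (B1 - {x}) \<in> indeps M \<and> insert x (B2 - {y}) \<in> indeps M}" for x
  have finA: "finite (A x)" for x using fin unfolding A_def by simp
  have no_matching: "\<nexists>f. inj_on f (B1 - B2) \<and> (\<forall>x \<in> B1 - B2. f x \<in> A x)"
  proof
    assume "\<exists>f. inj_on f (B1 - B2) \<and> (\<forall>x \<in> B1 - B2. f x \<in> A x)"
    then obtain f where inj: "inj_on f (B1 - B2)" and fA: "\<forall>x \<in> B1 - B2. f x \<in> A x" by blast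
    have "f ` (B1 - B2) \<subseteq> B2 - B1" using fA unfolding A_def by blast
    then have "f ` (B1 - B2) = B2 - B1"
      using card_image[OF inj] same fin by (intro card_subset_eq) simp_all
    then have bijf: "bij_betw f (B1 - B2) (B2 - B1)" using inj by (simp add: bij_betw_def)
    \<comment> \<open>On the common part the identity is the only possibility, and it is a valid exchange.\<close>
    define \<sigma> where "\<sigma> x = (if x \<in> B2 then x else f x)" for x
    have "bij_betw \<sigma> (B1 - B2) (B2 - B1)"
      using bijf by (rule bij_betw_cong[THEN iffD1, rotated]) (simp add: \<sigma>_def)
    moreover have "bij_betw \<sigma> (B1 \<inter> B2) (B1 \<inter> B2)"
      by (rule bij_betw_cong[THEN iffD1, OF _ bij_betw_id]) (simp add: \<sigma>_def)
    ultimately have "bij_betw \<sigma> ((B1 - B2) \<union> (B1 \<inter> B2)) ((B2 - B1) \<union> (B1 \<inter> B2))"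
      by (rule bij_betw_combine) blast
    moreover have "(B1 - B2) \<union> (B1 \<inter> B2) = B1" "(B2 - B1) \<union> (B1 \<inter> B2) = B2" by blast+
    ultimately have bij: "bij_betw \<sigma> B1 B2" by simp
    have "base M ((B1 - {x}) \<union> {\<sigma> x}) \<and> base M ((B2 - {\<sigma> x}) \<union> {x})" if x: "x \<in> B1" for x
    proof (cases "x \<in> B2")
      case True
      then show ?thesis using x B1 B2 by (simp add: \<sigma>_def insert_absorb)
    next
      case False
      then have "f x \<in> A x" using fA x by simp
      then have "f x \<in> B2 - B1" "insert (f x) (B1 - {x}) \<in> indeps M" "insert x (B2 - {f x}) \<in> indeps M"
        unfolding A_def by simp_all
      then show ?thesis
        using base_exchange_iff[OF B1 x, of "f x"] base_exchange_iff[OF B2 _ False, of "f x"] False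
        by (simp add: \<sigma>_def)
    qed
    then show False using none[OF bij] by blast
  qed
  have "\<exists>X. X \<subseteq> B1 - B2 \<and> card (\<Union>(A ` X)) < card X"
  proof (rule ccontr)
    assume "\<nexists>X. X \<subseteq> B1 - B2 \<and> card (\<Union>(A ` X)) < card X"
    then have "\<exists>f. inj_on f (B1 - B2) \<and> (\<forall>x \<in> B1 - B2. f x \<in> A x)"
      using fin finA by (intro hall_marriage) (simp_all add: not_less)
    then show False using no_matching by contradiction
  qed
  then obtain X where X: "X \<subseteq> B1 - B2" and deficient: "card (\<Union>(A ` X)) < card X"
    by blast
  define Y where "Y = (B2 - B1) - \<Union>(A ` X)"
  have Y: "Y \<subseteq> B2 - B1" unfolding Y_def by blast
  have blocked: "insert y (B1 - {x}) \<notin> indeps M \<or> insert x (B2 - {y}) \<notin> indeps M"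
    if "x \<in> X" "y \<in> Y" for x y
    using that unfolding Y_def A_def by blast
  have "card (B2 - B1) - card (\<Union>(A ` X)) \<le> card Y"
    unfolding Y_def
  proof (rule diff_card_le_card_Diff)
    have "finite X" using X fin(1) by (meson finite_Diff finite_subset)
    then show "finite (\<Union>(A ` X))" using finA by simp
  qed
  then have large: "card (B1 - B2) < card X + card Y" using deficient same by simp
  then have two: "card X = 2" "card Y = 2"
    using paving_blocked_rectangle[OF pav B1 B2 X Y] blocked by blast+
  then have small: "card (B1 - B2) \<le> 3" using large by simp
  obtain x1 x2 where x: "X = {x1, x2}" "x1 \<noteq> x2" using two(1) by (auto simp: card_2_iff)
  obtain y1 y2 where y: "Y = {y1, y2}" "y1 \<noteq> y2" using two(2) by (auto simp: card_2_iff)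
  have xs: "x1 \<in> B1 - B2" "x2 \<in> B1 - B2" and ys: "y1 \<in> B2 - B1" "y2 \<in> B2 - B1"
    using X Y x y by blast+
  \<comment> \<open>If \<open>(x1, y1)\<close> is blocked on the side of \<open>B2\<close> only, then \<open>(x1, y2)\<close> is blocked on the side of \<open>B1\<close>,
    and interchanging \<open>y1\<close> and \<open>y2\<close> gives the other case.\<close>
  show ?thesis
  proof (cases "insert y1 (B1 - {x1}) \<in> indeps M")
    case False
    show ?thesis
      by (rule K4_minor_if_blocked_square[OF pav B1 B2 small xs x(2) ys y(2) _ False])
        (use blocked x(1) y(1) in blast)
  next
    case True
    then have "insert x1 (B2 - {y1}) \<notin> indeps M" using blocked[of x1 y1] x y by blast
    moreover have "x1 \<in> ground M - B2" using xs indep_subset_ground[OF ind(1)] by blast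
    ultimately have "insert x1 (B2 - {y2}) \<in> indeps M"
      using paving_blocked_unique[OF pav B2, of x1 y1 y2] ys y(2) by blast
    then have start: "insert y2 (B1 - {x1}) \<notin> indeps M" using blocked[of x1 y2] x y by blast
    show ?thesis
      by (rule K4_minor_if_blocked_square[OF pav B1 B2 small xs x(2) ys(2,1) y(2)[symmetric] _ start])
        (use blocked x(1) y(1) in blast)
  qed
qed

end

theorem theorem3p5:
  fixes M :: "'a matroid_data"
  assumes "matroid M" and "paving M"
  shows "base_orderable M \<longleftrightarrow>
    \<not> (\<exists>N. minor N M \<and> matroid_isomorphic N (cycle_matroid (complete_graph 4)))"
proof -
  interpret matroid M by fact
  show ?thesis
    using K4_minor_if_not_base_orderable[OF assms(2)] not_base_orderable_if_K4_minor by blast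
qed

end
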